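(* For any integer $N\ge 2$, the number $I_{N}$ of consecutive irreducible polynomial sequences of length $N$ over $\mathbb{F}_q$ satisfies $$I_N < 2^{-N+1}q^{N+1}+N^2 q^{N+1/2}+ N^4 q^{N}.$$
   Context: Let $p$ be an odd prime, $q=p^s$ with $s\ge 1$ an integer, and $\mathbb{F}_q$ the finite field with $q$ elements. A consecutive irreducible polynomial sequence of length $N$ over $\mathbb{F}_q$ is a sequence $f_1,\ldots,f_N$ with $f_n=u_nX^n+\cdots+u_1X+u_0\in\mathbb{F}_q[X]$, where $u_0,u_1,\ldots,u_N$ are non-zero elements of $\mathbb{F}_q$, such that every $f_n$ ($1\le n\le N$) is irreducible over $\mathbb{F}_q$. $I_N$ denotes the number of such sequences (equivalently, of such tuples $(u_0,\ldots,u_N)$). *)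

theory Defs
  imports Complex_Main "HOL-Computational_Algebra.Computational_Algebra"
begin

(* Lists are 0-based: the polynomial f_n is the list entry fs ! (n - 1). *)
definition consecutive_irreducible_seq :: "nat \<Rightarrow> 'a::field poly list \<Rightarrow> bool" where
  "consecutive_irreducible_seq N fs \<longleftrightarrow>
     length fs = N \<and>
     (\<exists>u :: nat \<Rightarrow> 'a.
        (\<forall>i\<le>N. u i \<noteq> 0) \<and>
        (\<forall>n\<in>{1..N}. fs ! (n - 1) = (\<Sum>i\<le>n. monom (u i) i))) \<and>
     (\<forall>n\<in>{1..N}. irreducible (fs ! (n - 1)))"

(* The number I_N; the field is passed as a type argument. *)
definition num_consecutive_irreducible_seqs :: "'a::{field,finite} itself \<Rightarrow> nat \<Rightarrow> nat" where
  "num_consecutive_irreducible_seqs _ N =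
     card {fs :: 'a poly list. consecutive_irreducible_seq N fs}"

end

theory Submission
  imports Defs
begin

(* For n at least 2 an irreducible f_n has no root, and this necessary condition alone suffices.
   Reversing coefficients, y^n f_n(1/y) = u_n + y g(y) with g(y) = u_{n-1} + u_{n-2} y + ... + u_0 y^{n-1},
   so for given u_0, ..., u_{n-1} the leading coefficient u_n must avoid the values of -y g(y).
   By a Bonferroni inequality this value set has at least q - C/2 elements, C being the number
   of ordered pairs x \<noteq> y with x g(x) = y g(y). If n = 2 then C \<le> q; if n > 2 then, for random g,
   the collision events of distinct unordered pairs are pairwise independent, so C has
   mean q - 1 and variance at most 2q. Hence each step n multiplies the count by q/2,
   up to an error of order q^{n + 1/2}. *)

section \<open>Image sizes from collision counts\<close>

definition collisions :: "('a \<Rightarrow> 'b) \<Rightarrow> 'a set \<Rightarrow> ('a \<times> 'a) set" where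
  "collisions f S = {(x, y). x \<in> S \<and> y \<in> S \<and> x \<noteq> y \<and> f x = f y}"

lemma finite_collisions [simp]: "finite S \<Longrightarrow> finite (collisions f S)"
  by (rule finite_subset[of _ "S \<times> S"]) (auto simp: collisions_def)

text \<open>Points are added one at a time: a point whose value is already taken does not enlarge
  the image, but brings at least two new ordered collisions, one in each order.\<close>

lemma card_le_image_collisions:
  assumes "finite S"
  shows "2 * card S \<le> 2 * card (f ` S) + card (collisions f S)"
  using assms
proof (induction S rule: finite_induct)
  case empty
  then show ?case by simp
next
  case (insert x S)
  have sub: "collisions f S \<subseteq> collisions f (insert x S)"
    by (auto simp: collisions_def)
  show ?case
  proof (cases "f x \<in> f ` S")
    case True
    then obtain z where z: "z \<in> S" "f z = f x" by auto
    have "insert (x, z) (insert (z, x) (collisions f S)) \<subseteq> collisions f (insert x S)"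
      using z insert.hyps by (auto simp: collisions_def)
    then have "card (insert (x, z) (insert (z, x) (collisions f S))) \<le> card (collisions f (insert x S))"
      using insert.hyps by (intro card_mono) auto
    moreover have "(x, z) \<notin> insert (z, x) (collisions f S)" "(z, x) \<notin> collisions f S"
      using z insert.hyps by (auto simp: collisions_def)
    ultimately have "card (collisions f S) + 2 \<le> card (collisions f (insert x S))"
      using insert.hyps by simp
    moreover have "f ` insert x S = f ` S" using True by auto
    ultimately show ?thesis using insert by simp
  next
    case False
    have "card (collisions f S) \<le> card (collisions f (insert x S))"
      using sub insert.hyps by (intro card_mono) auto
    then show ?thesis using False insert by simp
  qed
qed

section \<open>Coefficient lists and the values y g(y)\<close>

definition lists_of_length :: "nat \<Rightarrow> 'a list set" where
  "lists_of_length m = {us. length us = m}"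

lemma lists_of_length_0 [simp]: "lists_of_length 0 = {[]}"
  by (auto simp: lists_of_length_def)

lemma finite_lists_of_length [simp]: "finite (lists_of_length m :: 'a::finite list set)"
  using finite_lists_length_eq[of "UNIV :: 'a set" m] by (simp add: lists_of_length_def)

lemma card_lists_of_length:
  "card (lists_of_length m :: 'a::finite list set) = card (UNIV :: 'a set) ^ m"
  using card_lists_length_eq[of "UNIV :: 'a set" m] by (simp add: lists_of_length_def)

text \<open>Putting the head in the inner sum allows averaging over one coefficient while the rest
  of the list stays fixed.\<close>

lemma sum_lists_of_length_Suc:
  fixes F :: "'a::finite list \<Rightarrow> 'b::comm_monoid_add"
  shows "sum F (lists_of_length (Suc m)) = (\<Sum>us\<in>lists_of_length m. \<Sum>a\<in>UNIV. F (a # us))"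
proof -
  have "lists_of_length (Suc m) = (\<lambda>(us, a). a # us) ` (lists_of_length m \<times> (UNIV :: 'a set))"
    by (auto simp: lists_of_length_def image_def length_Suc_conv)
  moreover have "inj_on (\<lambda>(us, a). a # us) (lists_of_length m \<times> (UNIV :: 'a set))"
    by (auto simp: inj_on_def)
  ultimately have "sum F (lists_of_length (Suc m))
      = (\<Sum>(us, a)\<in>lists_of_length m \<times> UNIV. F (a # us))"
    by (simp add: sum.reindex case_prod_unfold)
  then show ?thesis by (simp add: sum.cartesian_product)
qed

text \<open>This is y g(y), where \<open>us\<close> lists the coefficients of g from the constant
  term upwards. The factor y makes \<open>a + shifted_eval us y\<close> the value at y of
  \<open>Poly (a # us)\<close>.\<close>

definition shifted_eval :: "'a::comm_semiring_0 list \<Rightarrow> 'a \<Rightarrow> 'a" where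
  "shifted_eval us y = y * poly (Poly us) y"

lemma shifted_eval_Cons: "shifted_eval (a # us) y = y * (a + shifted_eval us y)"
  by (simp add: shifted_eval_def)

section \<open>Probabilities of single and joint collisions\<close>

lemma card_solutions_linear:
  fixes x y K L :: "'a::{field,finite}"
  assumes "x \<noteq> y"
  shows "(\<Sum>a\<in>UNIV. of_bool (x * (a + K) = y * (a + L)) :: real) = 1"
proof -
  have "x * (a + K) = y * (a + L) \<longleftrightarrow> a = (y * L - x * K) / (x - y)" for a
    using assms by (auto simp: field_simps)
  then show ?thesis by (simp add: sum.If_cases of_bool_def)
qed

text \<open>For each tail exactly one head makes x and y collide, so a single collision has
  probability 1/q.\<close>

lemma sum_shifted_eval_eq:
  fixes x y :: "'a::{field,finite}"
  assumes "x \<noteq> y"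
  shows "(\<Sum>us\<in>lists_of_length (Suc m). of_bool (shifted_eval us x = shifted_eval us y) :: real)
    = real (card (UNIV :: 'a set)) ^ m"
  using card_solutions_linear[OF assms]
  by (simp add: sum_lists_of_length_Suc shifted_eval_Cons card_lists_of_length)

text \<open>After division by x - y and z - w these are linear equations in a, b, c with rows (1, x
  + y, x^2 + xy + y^2) and (1, z + w, z^2 + zw + w^2). The rows are independent because sum and
  product determine an unordered pair. With only a and b, pairs of equal sum would give parallel
  rows; hence three unknowns. The function \<open>K\<close> stands for the contribution of all
  further coefficients.\<close>

lemma card_two_equations_le:
  fixes x y z w :: "'a::{field,finite}"
  assumes xy: "x \<noteq> y" and zw: "z \<noteq> w" and ne: "(z, w) \<noteq> (x, y)" "(z, w) \<noteq> (y, x)"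
  shows "card {(a, b, c).
      x * (a + x * (b + x * (c + K x))) = y * (a + y * (b + y * (c + K y))) \<and>
      z * (a + z * (b + z * (c + K z))) = w * (a + w * (b + w * (c + K w)))}
    \<le> card (UNIV :: 'a set)"
proof -
  define S where "S = {(a, b, c).
      x * (a + x * (b + x * (c + K x))) = y * (a + y * (b + y * (c + K y))) \<and>
      z * (a + z * (b + z * (c + K z))) = w * (a + w * (b + w * (c + K w)))}"
  define R where "R s t = (s ^ 3 * K s - t ^ 3 * K t) / (s - t)" for s t
  have quot: "a + b * (s + t) + c * (s\<^sup>2 + s * t + t\<^sup>2) = - R s t"
    if "s * (a + s * (b + s * (c + K s))) = t * (a + t * (b + t * (c + K t)))" "s \<noteq> t"
    for s t a b c
  proof -
    have "(s - t) * (a + b * (s + t) + c * (s\<^sup>2 + s * t + t\<^sup>2)) = - (s ^ 3 * K s - t ^ 3 * K t)"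
      using that(1) by algebra
    then show ?thesis using that(2) by (simp add: R_def field_simps)
  qed
  have eq1: "a + b * (x + y) + c * (x\<^sup>2 + x * y + y\<^sup>2) = - R x y"
    and eq2: "a + b * (z + w) + c * (z\<^sup>2 + z * w + w\<^sup>2) = - R z w"
    if "(a, b, c) \<in> S" for a b c
    using that quot xy zw by (auto simp: S_def)
  have "card S \<le> card (UNIV :: 'a set)"
  proof (cases "x + y = z + w")
    case False
    \<comment> \<open>Different sums: the first two columns form an invertible minor, so c
      determines a and b.\<close>
    have "a = a' \<and> b = b'" if "(a, b, c) \<in> S" "(a', b', c) \<in> S"
      for a b c a' b'
    proof -
      note e = eq1[OF that(1)] eq2[OF that(1)] eq1[OF that(2)] eq2[OF that(2)]
      have "(b - b') * ((x + y) - (z + w)) = 0" using e by algebra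
      then have "b = b'" using False by simp
      moreover from this have "a = a'" using e(1,3) by (metis add_right_cancel)
      ultimately show ?thesis by simp
    qed
    then have "inj_on (\<lambda>(a, b, c). c) S" by (auto simp: inj_on_def)
    then show ?thesis by (rule card_inj_on_le) auto
  next
    case True
    \<comment> \<open>With equal sums, equal quadratic entries would mean equal products, making z a
      root of (T - x)(T - y).\<close>
    have nq: "x\<^sup>2 + x * y + y\<^sup>2 \<noteq> z\<^sup>2 + z * w + w\<^sup>2"
    proof
      assume "x\<^sup>2 + x * y + y\<^sup>2 = z\<^sup>2 + z * w + w\<^sup>2"
      then have "(z - x) * (z - y) = 0" using True by algebra
      then show False using True ne by auto
    qed
    have "a = a' \<and> c = c'" if "(a, b, c) \<in> S" "(a', b, c') \<in> S"
      for a b c a' c'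
    proof -
      note e = eq1[OF that(1)] eq2[OF that(1)] eq1[OF that(2)] eq2[OF that(2)]
      have "(c - c') * ((x\<^sup>2 + x * y + y\<^sup>2) - (z\<^sup>2 + z * w + w\<^sup>2)) = 0"
        using e True by algebra
      then have "c = c'" using nq by simp
      moreover from this have "a = a'" using e(1,3) by (metis add_right_cancel)
      ultimately show ?thesis by simp
    qed
    then have "inj_on (\<lambda>(a, b, c). b) S" by (auto simp: inj_on_def)
    then show ?thesis by (rule card_inj_on_le) auto
  qed
  then show ?thesis by (simp only: S_def)
qed

text \<open>All but the first three coefficients are fixed and enter through \<open>K\<close>. The
  joint probability is then at most 1/q^2, the half of pairwise independence that an upper bound on
  the variance requires.\<close>

lemma sum_two_shifted_eval_eq_le:
  fixes x y z w :: "'a::{field,finite}"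
  assumes "x \<noteq> y" "z \<noteq> w" "(z, w) \<noteq> (x, y)" "(z, w) \<noteq> (y, x)"
  shows "(\<Sum>us\<in>lists_of_length (Suc (Suc (Suc k))).
      of_bool (shifted_eval us x = shifted_eval us y) * of_bool (shifted_eval us z = shifted_eval us w) :: real)
    \<le> real (card (UNIV :: 'a set)) ^ Suc k"
proof -
  have inner: "(\<Sum>c\<in>UNIV. \<Sum>b\<in>UNIV. \<Sum>a\<in>UNIV.
      of_bool (x * (a + x * (b + x * (c + K x))) = y * (a + y * (b + y * (c + K y)))) *
      of_bool (z * (a + z * (b + z * (c + K z))) = w * (a + w * (b + w * (c + K w)))) :: real)
    \<le> real (card (UNIV :: 'a set))" for K :: "'a \<Rightarrow> 'a"
  proof -
    let ?P = "\<lambda>a b c. x * (a + x * (b + x * (c + K x))) = y * (a + y * (b + y * (c + K y))) \<and>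
      z * (a + z * (b + z * (c + K z))) = w * (a + w * (b + w * (c + K w)))"
    have "(\<Sum>c\<in>UNIV. \<Sum>b\<in>UNIV. \<Sum>a\<in>UNIV. of_bool (?P a b c) :: real)
        = (\<Sum>a\<in>UNIV. \<Sum>b\<in>UNIV. \<Sum>c\<in>UNIV. of_bool (?P a b c))"
      by (subst sum.swap, subst (2) sum.swap, subst sum.swap) simp
    also have "\<dots> = (\<Sum>(a, b, c)\<in>UNIV. of_bool (?P a b c))"
      by (simp only: sum.cartesian_product UNIV_Times_UNIV)
    also have "\<dots> = real (card {(a, b, c). ?P a b c})"
      by (simp add: case_prod_unfold)
    also have "\<dots> \<le> real (card (UNIV :: 'a set))"
      using card_two_equations_le[OF assms] by (simp only: of_nat_le_iff)
    finally show ?thesis by (simp only: of_bool_conj)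
  qed
  have "(\<Sum>us\<in>lists_of_length (Suc (Suc (Suc k))).
      of_bool (shifted_eval us x = shifted_eval us y) * of_bool (shifted_eval us z = shifted_eval us w) :: real)
    \<le> (\<Sum>us\<in>(lists_of_length k :: 'a list set). real (card (UNIV :: 'a set)))"
    unfolding sum_lists_of_length_Suc shifted_eval_Cons by (intro sum_mono inner)
  also have "\<dots> = real (card (UNIV :: 'a set)) ^ Suc k"
    by (simp add: card_lists_of_length)
  finally show ?thesis .
qed

section \<open>Mean and variance of the number of collisions\<close>

definition num_collisions :: "'a::{field,finite} list \<Rightarrow> nat" where
  "num_collisions us = card (collisions (shifted_eval us) UNIV)"

lemma num_collisions_eq_sum:
  "real (num_collisions us) =
    (\<Sum>p\<in>{(x, y). x \<noteq> y}. of_bool (shifted_eval us (fst p) = shifted_eval us (snd p)))"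
proof -
  have "collisions (shifted_eval us) UNIV
      = {(x, y). x \<noteq> y} \<inter> {p. shifted_eval us (fst p) = shifted_eval us (snd p)}"
    by (auto simp: collisions_def)
  then show ?thesis
    by (simp add: num_collisions_def)
qed

lemma card_offdiagonal:
  "real (card {(x, y :: 'a::finite). x \<noteq> y})
    = real (card (UNIV :: 'a set)) * (real (card (UNIV :: 'a set)) - 1)"
proof -
  have "{(x, y :: 'a). x \<noteq> y} = UNIV - range (\<lambda>x. (x, x))" by auto
  then have "card {(x, y :: 'a). x \<noteq> y} = card (UNIV :: ('a \<times> 'a) set) - card (range (\<lambda>x :: 'a. (x, x)))"
    by (simp add: card_Diff_subset)
  also have "card (range (\<lambda>x :: 'a. (x, x))) = card (UNIV :: 'a set)"
    by (rule card_image) (auto simp: inj_on_def)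
  also have "card (UNIV :: ('a \<times> 'a) set) = card (UNIV :: 'a set) * card (UNIV :: 'a set)"
    using card_cartesian_product[of "UNIV :: 'a set" "UNIV :: 'a set"] by simp
  finally show ?thesis by (simp add: of_nat_diff algebra_simps)
qed

text \<open>The second moment expands over two ordered pairs p, p'. Only p' = p and its transpose
  are fully correlated with p, and these contribute the excess 2 (q - 1) over the squared
  mean.\<close>

lemma num_collisions_variance:
  fixes k :: nat
  defines "q \<equiv> real (card (UNIV :: 'a::{field,finite} set))"
  shows "(\<Sum>us\<in>(lists_of_length (Suc (Suc (Suc k))) :: 'a list set). (real (num_collisions us) - (q - 1))\<^sup>2)
    \<le> 2 * q * q ^ Suc (Suc (Suc k))"
proof -
  define W :: "'a list set" where "W = lists_of_length (Suc (Suc (Suc k)))"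
  define P :: "('a \<times> 'a) set" where "P = {(x, y). x \<noteq> y}"
  define e :: "'a list \<Rightarrow> 'a \<times> 'a \<Rightarrow> real"
    where "e us p = of_bool (shifted_eval us (fst p) = shifted_eval us (snd p))" for us p
  have q1: "q \<ge> 1"
    unfolding q_def using finite_UNIV_card_ge_0[where 'a = 'a] by simp
  have cardP: "real (card P) = q * (q - 1)"
    unfolding P_def q_def by (rule card_offdiagonal)
  have cardW: "real (card W) = q ^ Suc (Suc (Suc k))"
    by (simp add: W_def card_lists_of_length q_def)
  have C: "real (num_collisions us) = sum (e us) P" for us
    unfolding e_def P_def by (rule num_collisions_eq_sum)
  have single: "(\<Sum>us\<in>W. e us p) = q ^ Suc (Suc k)" if "p \<in> P" for p
    using that sum_shifted_eval_eq[of "fst p" "snd p" "Suc (Suc k)"]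
    by (auto simp: W_def e_def P_def q_def)
  have first: "(\<Sum>us\<in>W. real (num_collisions us)) = q ^ Suc (Suc (Suc k)) * (q - 1)"
    unfolding C by (subst sum.swap) (simp add: single cardP)
  have pair: "(\<Sum>p'\<in>P. \<Sum>us\<in>W. e us p * e us p') \<le> q * (q - 1) * q ^ Suc k + 2 * q ^ Suc (Suc k)"
    if p: "p \<in> P" for p
  proof -
    \<comment> \<open>The generic bound is kept for every p', the two exceptional ones included, so
      that the sum over \<open>P\<close> splits into a constant part and a correction with at most
      two terms.\<close>
    have "(\<Sum>us\<in>W. e us p * e us p')
        \<le> q ^ Suc k + (if p' \<in> {p, prod.swap p} then q ^ Suc (Suc k) else 0)" if p': "p' \<in> P" for p'
    proof (cases "p' \<in> {p, prod.swap p}")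
      case True
      have "(\<Sum>us\<in>W. e us p * e us p') \<le> (\<Sum>us\<in>W. e us p)"
        by (intro sum_mono) (auto simp: e_def)
      also have "\<dots> = q ^ Suc (Suc k)" by (rule single[OF p])
      finally show ?thesis using True q1 by (simp add: add_increasing)
    next
      case False
      then show ?thesis
        using p p' sum_two_shifted_eval_eq_le[of "fst p" "snd p" "fst p'" "snd p'" k]
        by (cases p, cases p') (auto simp: W_def e_def P_def q_def)
    qed
    then have "(\<Sum>p'\<in>P. \<Sum>us\<in>W. e us p * e us p')
        \<le> (\<Sum>p'\<in>P. q ^ Suc k + (if p' \<in> {p, prod.swap p} then q ^ Suc (Suc k) else 0))"
      by (rule sum_mono)
    also have "\<dots> = q * (q - 1) * q ^ Suc k + (\<Sum>p'\<in>P \<inter> {p, prod.swap p}. q ^ Suc (Suc k))"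
      by (subst sum.distrib, subst sum.inter_restrict[symmetric]) (simp_all add: cardP)
    also have "(\<Sum>p'\<in>P \<inter> {p, prod.swap p}. q ^ Suc (Suc k)) \<le> (\<Sum>p'\<in>{p, prod.swap p}. q ^ Suc (Suc k))"
      using q1 by (intro sum_mono2) auto
    also have "\<dots> \<le> 2 * q ^ Suc (Suc k)"
    proof -
      have "real (card {p, prod.swap p}) \<le> 2" by (simp add: card_insert_if)
      then show ?thesis using q1 by (simp add: mult_right_mono)
    qed
    finally show ?thesis by simp
  qed
  have "(\<Sum>us\<in>W. (real (num_collisions us))\<^sup>2) = (\<Sum>p\<in>P. \<Sum>p'\<in>P. \<Sum>us\<in>W. e us p * e us p')"
  proof -
    have "(\<Sum>us\<in>W. (real (num_collisions us))\<^sup>2) = (\<Sum>us\<in>W. \<Sum>p\<in>P. \<Sum>p'\<in>P. e us p * e us p')"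
      by (simp add: C power2_eq_square sum_product)
    also have "\<dots> = (\<Sum>p\<in>P. \<Sum>us\<in>W. \<Sum>p'\<in>P. e us p * e us p')" by (rule sum.swap)
    also have "\<dots> = (\<Sum>p\<in>P. \<Sum>p'\<in>P. \<Sum>us\<in>W. e us p * e us p')"
      by (intro sum.cong refl sum.swap)
    finally show ?thesis .
  qed
  also have "\<dots> \<le> (\<Sum>p\<in>P. q * (q - 1) * q ^ Suc k + 2 * q ^ Suc (Suc k))"
    by (intro sum_mono pair)
  also have "\<dots> = q ^ Suc (Suc (Suc k)) * ((q - 1)\<^sup>2 + 2 * (q - 1))"
    by (simp add: cardP power2_eq_square algebra_simps)
  finally have second: "(\<Sum>us\<in>W. (real (num_collisions us))\<^sup>2)
      \<le> q ^ Suc (Suc (Suc k)) * ((q - 1)\<^sup>2 + 2 * (q - 1))" .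
  have "(\<Sum>us\<in>W. (real (num_collisions us) - (q - 1))\<^sup>2)
      = (\<Sum>us\<in>W. (real (num_collisions us))\<^sup>2 - 2 * (q - 1) * real (num_collisions us) + (q - 1)\<^sup>2)"
    by (intro sum.cong refl) (simp add: power2_eq_square algebra_simps)
  also have "\<dots> = (\<Sum>us\<in>W. (real (num_collisions us))\<^sup>2)
      - 2 * (q - 1) * (\<Sum>us\<in>W. real (num_collisions us)) + real (card W) * (q - 1)\<^sup>2"
    by (simp add: sum.distrib sum_subtractf sum_distrib_left)
  \<comment> \<open>The mean is known exactly, so it may be substituted in the negative term; only
    the second moment is estimated.\<close>
  also have "\<dots> \<le> q ^ Suc (Suc (Suc k)) * ((q - 1)\<^sup>2 + 2 * (q - 1))
      - 2 * (q - 1) * (q ^ Suc (Suc (Suc k)) * (q - 1)) + q ^ Suc (Suc (Suc k)) * (q - 1)\<^sup>2"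
    unfolding first cardW using second by linarith
  also have "\<dots> = q ^ Suc (Suc (Suc k)) * (2 * (q - 1))"
    by (simp add: power2_eq_square algebra_simps)
  also have "\<dots> \<le> 2 * q * q ^ Suc (Suc (Suc k))"
    using q1 by (simp add: mult.commute mult_right_mono)
  finally show ?thesis unfolding W_def .
qed

text \<open>Colliding points of the quadratic y (u + v y) have sum - u / v, so each x has at most
  one partner. This covers length 2, where collisions of different pairs need not be
  independent.\<close>

lemma num_collisions_quadratic_le:
  fixes u v :: "'a::{field,finite}"
  assumes "v \<noteq> 0"
  shows "num_collisions [u, v] \<le> card (UNIV :: 'a set)"
proof -
  have partner: "y = - u / v - x" if "x \<noteq> y" "shifted_eval [u, v] x = shifted_eval [u, v] y" for x y
  proof -
    have "(x - y) * (u + v * (x + y)) = 0"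
      using that(2) unfolding shifted_eval_def by simp algebra
    then have "u + v * (x + y) = 0" using that(1) by simp
    then have "v * y = - u - v * x" by algebra
    then show ?thesis using assms by (simp add: field_simps)
  qed
  have "snd p = - u / v - fst p" if "p \<in> collisions (shifted_eval [u, v]) UNIV" for p
    using that partner[of "fst p" "snd p"] by (cases p) (simp add: collisions_def)
  then have "inj_on fst (collisions (shifted_eval [u, v]) UNIV)"
    by (intro inj_onI prod_eqI) metis+
  then show ?thesis unfolding num_collisions_def by (rule card_inj_on_le) auto
qed

(* Coefficients are listed from u_n down to u_0, so that Poly yields the reciprocal polynomial
   of f_n and the tails of the list belong to f_{n-1}, f_{n-2}, ... *)
primrec rootfree :: "'a::field list \<Rightarrow> bool" where
  "rootfree [] = True"
| "rootfree (a # us) = (rootfree us \<and> a \<noteq> 0 \<and> (length us \<ge> 2 \<longrightarrow> (\<forall>y. a + shifted_eval us y \<noteq> 0)))"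

section \<open>Counting root-free lists by recursion on the length\<close>

definition rootfree_lists :: "nat \<Rightarrow> 'a::field list set" where
  "rootfree_lists m = {us \<in> lists_of_length m. rootfree us}"

lemma finite_rootfree_lists [simp]: "finite (rootfree_lists m :: 'a::{field,finite} list set)"
  by (simp add: rootfree_lists_def)

text \<open>The admissible a form the complement of the negated value set, whose size is bounded
  below through the collisions.\<close>

lemma card_extensions_le:
  fixes us :: "'a::{field,finite} list"
  shows "2 * card {a. \<forall>y. a + shifted_eval us y \<noteq> 0} \<le> num_collisions us"
proof -
  let ?f = "shifted_eval us"
  have "{a. \<forall>y. a + ?f y \<noteq> 0} = UNIV - uminus ` range ?f"
    by (auto simp: add_eq_0_iff2 image_iff)
  then have "card {a. \<forall>y. a + ?f y \<noteq> 0} = card (UNIV :: 'a set) - card (uminus ` range ?f)"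
    by (simp add: card_Diff_subset)
  moreover have "card (uminus ` range ?f) = card (range ?f)"
    by (rule card_image) (auto simp: inj_on_def)
  moreover have "2 * card (UNIV :: 'a set) \<le> 2 * card (range ?f) + num_collisions us"
    unfolding num_collisions_def by (rule card_le_image_collisions) simp
  ultimately show ?thesis by simp
qed

text \<open>Tails of root-free lists are root-free, so it suffices to count admissible heads over
  each tail. From m = 2 on, the new polynomial has degree at least 2 and the root condition
  applies.\<close>

lemma card_rootfree_lists_Suc_le:
  assumes "m \<ge> 2"
  shows "2 * card (rootfree_lists (Suc m) :: 'a::{field,finite} list set)
    \<le> (\<Sum>us\<in>(rootfree_lists m :: 'a list set). num_collisions us)"
proof -
  have "rootfree_lists (Suc m)
      \<subseteq> (\<lambda>(us, a). a # us) ` (SIGMA us:(rootfree_lists m :: 'a list set). {a. \<forall>y. a + shifted_eval us y \<noteq> 0})"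
    using assms by (auto simp: rootfree_lists_def lists_of_length_def length_Suc_conv image_iff)
  then have "card (rootfree_lists (Suc m) :: 'a list set)
      \<le> card (SIGMA us:(rootfree_lists m :: 'a list set). {a. \<forall>y. a + shifted_eval us y \<noteq> 0})"
    by (rule surj_card_le[rotated]) simp
  also have "\<dots> = (\<Sum>us\<in>(rootfree_lists m :: 'a list set). card {a. \<forall>y. a + shifted_eval us y \<noteq> 0})"
    by simp
  finally have "2 * card (rootfree_lists (Suc m) :: 'a list set)
      \<le> (\<Sum>us\<in>(rootfree_lists m :: 'a list set). 2 * card {a. \<forall>y. a + shifted_eval us y \<noteq> 0})"
    unfolding sum_distrib_left[symmetric] by (rule mult_le_mono2)
  also have "\<dots> \<le> (\<Sum>us\<in>(rootfree_lists m :: 'a list set). num_collisions us)"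
    by (intro sum_mono card_extensions_le)
  finally show ?thesis .
qed

text \<open>Root-free lists may be a biased sample, so the mean over all lists does not apply to
  them directly. The excess over q is instead bounded by a nonnegative quantity that can be summed
  over all lists.\<close>

lemma sum_num_collisions_rootfree_le:
  fixes m :: nat
  defines "q \<equiv> real (card (UNIV :: 'a::{field,finite} set))"
  assumes "m \<ge> 2"
  shows "(\<Sum>us\<in>(rootfree_lists m :: 'a list set). real (num_collisions us))
    \<le> q * real (card (rootfree_lists m :: 'a list set)) + 2 * q ^ m * sqrt q"
proof (cases "m = 2")
  case True
  have "real (num_collisions us) \<le> q" if "us \<in> rootfree_lists m" for us :: "'a list"
  proof -
    from that True obtain u v where "us = [u, v]" "v \<noteq> 0"
      by (auto simp: rootfree_lists_def lists_of_length_def length_Suc_conv numeral_2_eq_2)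
    then show ?thesis
      using num_collisions_quadratic_le[of v u] by (simp add: q_def)
  qed
  then have "(\<Sum>us\<in>(rootfree_lists m :: 'a list set). real (num_collisions us))
      \<le> (\<Sum>us\<in>(rootfree_lists m :: 'a list set). q)"
    by (rule sum_mono)
  moreover have "0 \<le> 2 * q ^ m * sqrt q" by (simp add: q_def)
  ultimately show ?thesis by (simp add: mult.commute)
next
  case False
  with assms(2) obtain k where m: "m = Suc (Suc (Suc k))"
    by (metis One_nat_def Suc_1 Suc_le_D Suc_le_mono le_antisym not_less_eq_eq numeral_2_eq_2)
  have q0: "q > 0"
    unfolding q_def using finite_UNIV_card_ge_0[where 'a = 'a] by simp
  define D where "D us = real (num_collisions us) - (q - 1)" for us :: "'a list"
  \<comment> \<open>Square completion with weight \<open>sqrt q\<close>, the order of the standard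
    deviation, balances the two error terms.\<close>
  have D_le: "real (num_collisions us) \<le> q + (sqrt q / 2 + (D us)\<^sup>2 / (2 * sqrt q))" for us :: "'a list"
  proof -
    have "0 \<le> (D us - sqrt q)\<^sup>2" by simp
    then have "2 * sqrt q * D us \<le> q + (D us)\<^sup>2"
      using q0 by (simp add: power2_diff mult_ac)
    then have "D us \<le> (q + (D us)\<^sup>2) / (2 * sqrt q)"
      using q0 by (simp add: pos_le_divide_eq mult_ac)
    also have "\<dots> = sqrt q / 2 + (D us)\<^sup>2 / (2 * sqrt q)"
    proof -
      have "q / (2 * sqrt q) = (q / sqrt q) / 2" by simp
      then show ?thesis using q0 by (simp add: add_divide_distrib real_div_sqrt)
    qed
    finally show ?thesis by (simp add: D_def)
  qed
  have "(\<Sum>us\<in>(rootfree_lists m :: 'a list set). real (num_collisions us))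
      \<le> (\<Sum>us\<in>(rootfree_lists m :: 'a list set). q + (sqrt q / 2 + (D us)\<^sup>2 / (2 * sqrt q)))"
    by (intro sum_mono D_le)
  also have "\<dots> = q * real (card (rootfree_lists m :: 'a list set))
      + (\<Sum>us\<in>rootfree_lists m. sqrt q / 2 + (D us)\<^sup>2 / (2 * sqrt q))"
    by (simp add: sum.distrib)
  \<comment> \<open>The summands are nonnegative, so the sum may be extended to all lists, where the
    variance bound is available.\<close>
  also have "(\<Sum>us\<in>rootfree_lists m. sqrt q / 2 + (D us)\<^sup>2 / (2 * sqrt q))
      \<le> (\<Sum>us\<in>lists_of_length m. sqrt q / 2 + (D us)\<^sup>2 / (2 * sqrt q))"
    using q0 by (intro sum_mono2) (auto simp: rootfree_lists_def)
  also have "\<dots> = q ^ m * (sqrt q / 2) + (\<Sum>us\<in>lists_of_length m. (D us)\<^sup>2) / (2 * sqrt q)"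
    by (simp add: sum.distrib card_lists_of_length q_def sum_divide_distrib)
  also have "\<dots> \<le> q ^ m * (sqrt q / 2) + (2 * q * q ^ m) / (2 * sqrt q)"
    using q0 num_collisions_variance[where 'a = 'a, of k]
    by (intro add_left_mono divide_right_mono) (simp_all add: D_def m q_def)
  also have "(2 * q * q ^ m) / (2 * sqrt q) = q ^ m * sqrt q"
  proof -
    have "(2 * q * q ^ m) / (2 * sqrt q) = q ^ m * (q / sqrt q)" by simp
    then show ?thesis using q0 by (simp only: real_div_sqrt less_imp_le)
  qed
  also have "q ^ m * (sqrt q / 2) + q ^ m * sqrt q \<le> 2 * q ^ m * sqrt q"
    using q0 by simp
  finally show ?thesis by simp
qed

text \<open>An error constant E becomes E/2 + 1 in each step. Its fixed point E = 2 keeps the error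
  from accumulating with the length.\<close>

lemma card_rootfree_lists_le:
  fixes m :: nat
  defines "q \<equiv> real (card (UNIV :: 'a::{field,finite} set))"
  shows "real (card (rootfree_lists (m + 2) :: 'a list set))
    \<le> q ^ (m + 2) / 2 ^ m + 2 * q ^ (m + 1) * sqrt q"
proof (induction m)
  case 0
  have "card (rootfree_lists 2 :: 'a list set) \<le> card (lists_of_length 2 :: 'a list set)"
    by (intro card_mono) (auto simp: rootfree_lists_def)
  then have "real (card (rootfree_lists 2 :: 'a list set)) \<le> q ^ 2"
    unfolding q_def card_lists_of_length by (simp flip: of_nat_power)
  moreover have "0 \<le> 2 * q * sqrt q" by (simp add: q_def)
  ultimately show ?case by (simp add: numeral_2_eq_2)
next
  case (Suc m)
  have q0: "q \<ge> 0" by (simp add: q_def)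
  have "2 * real (card (rootfree_lists (Suc (m + 2)) :: 'a list set))
      \<le> (\<Sum>us\<in>(rootfree_lists (m + 2) :: 'a list set). real (num_collisions us))"
    using card_rootfree_lists_Suc_le[where 'a = 'a, of "m + 2"]
    by (simp flip: of_nat_sum)
  also have "\<dots> \<le> q * real (card (rootfree_lists (m + 2) :: 'a list set)) + 2 * q ^ (m + 2) * sqrt q"
    unfolding q_def by (rule sum_num_collisions_rootfree_le) simp
  also have "\<dots> \<le> q * (q ^ (m + 2) / 2 ^ m + 2 * q ^ (m + 1) * sqrt q) + 2 * q ^ (m + 2) * sqrt q"
    using Suc.IH q0 by (intro add_right_mono mult_left_mono)
  also have "\<dots> = 2 * (q ^ (Suc m + 2) / 2 ^ Suc m + 2 * q ^ (Suc m + 1) * sqrt q)"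
    by (simp add: field_simps)
  finally show ?case by (simp only: add_Suc mult_le_cancel_left_pos zero_less_numeral)
qed

section \<open>From irreducible sequences to root-free lists\<close>

lemma irreducible_imp_no_root:
  fixes f :: "'a::field poly"
  assumes "irreducible f" "degree f \<ge> 2"
  shows "poly f x \<noteq> 0"
proof
  assume "poly f x = 0"
  then obtain g where g: "f = [:-x, 1:] * g" by (auto simp: poly_eq_0_iff_dvd)
  have "g dvd 1"
    using irreducibleD[OF assms(1) g] by (auto simp: is_unit_iff_degree)
  moreover from this have "g \<noteq> 0" by auto
  ultimately have "degree g = 0" "g \<noteq> 0" using is_unit_iff_degree by blast+
  then have "degree f = 1" unfolding g by (subst degree_mult_eq) auto
  with assms(2) show False by simp
qed

text \<open>Reversing coefficients gives the reciprocal polynomial, so nonzero roots correspond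
  under inversion.\<close>

lemma poly_Poly_rev_upt:
  fixes u :: "nat \<Rightarrow> 'a::field"
  assumes "y \<noteq> 0"
  shows "poly (Poly (map u (rev [0..<Suc n]))) y = y ^ n * poly (\<Sum>i\<le>n. monom (u i) i) (inverse y)"
proof (induction n)
  case 0
  then show ?case by (simp add: poly_monom)
next
  case (Suc n)
  then show ?case
    using assms by (simp add: poly_sum poly_monom power_inverse algebra_simps)
qed

lemma rootfree_rev_upt:
  fixes u :: "nat \<Rightarrow> 'a::field"
  assumes "\<And>i. i \<le> n \<Longrightarrow> u i \<noteq> 0"
    and "\<And>k. 1 \<le> k \<Longrightarrow> k \<le> n \<Longrightarrow> irreducible (\<Sum>i\<le>k. monom (u i) i)"
  shows "rootfree (map u (rev [0..<Suc n]))"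
  using assms
proof (induction n)
  case 0
  then show ?case by simp
next
  case (Suc n)
  let ?us = "map u (rev [0..<Suc n])" and ?f = "\<Sum>i\<le>Suc n. monom (u i) i"
  have split: "map u (rev [0..<Suc (Suc n)]) = u (Suc n) # ?us" by simp
  have IH: "rootfree ?us" using Suc by auto
  have "u (Suc n) + shifted_eval ?us y \<noteq> 0" if "n \<ge> 1" for y
  proof (cases "y = 0")
    case True
    then show ?thesis using Suc.prems(1)[of "Suc n"] by (simp add: shifted_eval_def)
  next
    case False
    have "coeff ?f (Suc n) = u (Suc n)" by (simp add: coeff_sum)
    then have "degree ?f \<ge> 2"
      using le_degree[of ?f "Suc n"] Suc.prems(1)[of "Suc n"] that by simp
    then have "poly ?f (inverse y) \<noteq> 0"
      using Suc.prems(2)[of "Suc n"] by (intro irreducible_imp_no_root) auto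
    then have "poly (Poly (map u (rev [0..<Suc (Suc n)]))) y \<noteq> 0"
      using poly_Poly_rev_upt[OF False, of u "Suc n"] False by simp
    then show ?thesis unfolding split by (simp add: shifted_eval_def)
  qed
  then show ?case unfolding split using IH Suc.prems(1)[of "Suc n"] by (simp del: upt_Suc)
qed

text \<open>\<open>?F\<close> rebuilds a sequence from its N + 1 coefficients, so all sequences lie
  in the image of the root-free lists; \<open>rev\<close> restores the ascending order.\<close>

lemma num_consecutive_irreducible_seqs_le:
  "num_consecutive_irreducible_seqs TYPE('a::{field,finite}) N
    \<le> card (rootfree_lists (Suc N) :: 'a list set)"
proof -
  let ?F = "\<lambda>us :: 'a list. map (\<lambda>n. \<Sum>i\<le>n. monom (rev us ! i) i) [1..<Suc N]"
  have "{fs :: 'a poly list. consecutive_irreducible_seq N fs} \<subseteq> ?F ` rootfree_lists (Suc N)"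
  proof
    fix fs :: "'a poly list"
    assume "fs \<in> {fs. consecutive_irreducible_seq N fs}"
    then obtain u :: "nat \<Rightarrow> 'a" where len: "length fs = N" and u: "\<forall>i\<le>N. u i \<noteq> 0"
      and fs: "\<forall>n\<in>{1..N}. fs ! (n - 1) = (\<Sum>i\<le>n. monom (u i) i)"
      and irr: "\<forall>n\<in>{1..N}. irreducible (fs ! (n - 1))"
      unfolding consecutive_irreducible_seq_def by auto
    let ?us = "map u (rev [0..<Suc N])"
    have "?us \<in> rootfree_lists (Suc N)"
      using rootfree_rev_upt[of N u] u fs irr
      by (simp add: rootfree_lists_def lists_of_length_def del: upt_Suc)
    moreover have "fs = ?F ?us"
    proof (rule nth_equalityI)
      show "length fs = length (?F ?us)" using len by simp
    next
      fix j assume j: "j < length fs"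
      have "?F ?us ! j = (\<Sum>i\<le>Suc j. monom (u i) i)"
        using j len by (auto simp: rev_map nth_append simp del: upt_Suc sum.atMost_Suc intro!: sum.cong)
      also have "\<dots> = fs ! j"
        using bspec[OF fs, of "Suc j"] j len by simp
      finally show "fs ! j = ?F ?us ! j" ..
    qed
    ultimately show "fs \<in> ?F ` rootfree_lists (Suc N)" by blast
  qed
  then show ?thesis
    unfolding num_consecutive_irreducible_seqs_def by (rule surj_card_le[rotated]) simp
qed

theorem theorem5p4:
  fixes p s q N :: nat
  assumes "prime p" and "odd p" and "s \<ge> 1" and "q = p ^ s"
    and "card (UNIV :: 'a::{field,finite} set) = q"
    and "N \<ge> 2"
  shows "real (num_consecutive_irreducible_seqs TYPE('a) N) <
           2 powr (- real N + 1) * real q ^ (N + 1)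
           + real N ^ 2 * real q powr (real N + 1 / 2)
           + real N ^ 4 * real q ^ N"
proof -
  have q0: "real q > 0"
    using finite_UNIV_card_ge_0[where 'a = 'a] assms(5) by simp
  \<comment> \<open>With N = m + 1, the lists have length N + 1 = m + 2 and the main term has
    denominator 2^(N-1) = 2^m.\<close>
  from assms(6) obtain m where N: "N = Suc m" by (cases N) auto
  have "real (num_consecutive_irreducible_seqs TYPE('a) N)
      \<le> real q ^ (N + 1) / 2 ^ m + 2 * real q ^ N * sqrt (real q)"
    using num_consecutive_irreducible_seqs_le[where 'a = 'a, of N]
      card_rootfree_lists_le[where 'a = 'a, of m] assms(5)
    by (simp add: N)
  also have "real q ^ (N + 1) / 2 ^ m = 2 powr (- real N + 1) * real q ^ (N + 1)"
    by (simp add: N powr_minus powr_realpow field_simps)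
  also have "2 * real q ^ N * sqrt (real q) \<le> real N ^ 2 * real q powr (real N + 1 / 2)"
  proof -
    \<comment> \<open>The error constant 2 is absorbed by N^2, which is at least 4.\<close>
    have "real N ^ 2 \<ge> 2 ^ 2" using assms(6) by (intro power_mono) auto
    moreover have "real q powr (real N + 1 / 2) = real q ^ N * sqrt (real q)"
      using q0 by (simp add: powr_add powr_realpow powr_half_sqrt)
    ultimately show ?thesis using q0 by (simp add: mult.assoc mult_right_mono)
  qed
  finally have "real (num_consecutive_irreducible_seqs TYPE('a) N)
      \<le> 2 powr (- real N + 1) * real q ^ (N + 1) + real N ^ 2 * real q powr (real N + 1 / 2)"
    by simp
  \<comment> \<open>Adding this positive term makes the inequality strict.\<close>
  moreover have "0 < real N ^ 4 * real q ^ N" using q0 assms(6) by simp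
  ultimately show ?thesis by linarith
qed

end
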